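(* Let $(X,d)$ be a complete $b$-metric space with parameter $b\geq 1$, let $k$ be a positive integer, and let $f:X^{k}\rightarrow X$ be a mapping for which there is a constant $\eta\in(0,1)$ such that $$d(f(x_{1},\ldots,x_{k}),f(x_{2},\ldots,x_{k+1}))\leq \eta\max_{1\leq i\leq k}\{d(x_{i},x_{i+1})\}$$ for all $x_{1},\ldots,x_{k+1}\in X$. Then there exists $x\in X$ such that $f(x,\ldots,x)=x$. Furthermore, if $x_{1},\ldots,x_{k}$ are arbitrary points in $X$ and $x_{n+k}=f(x_{n},\ldots,x_{n+k-1})$ for all positive integers $n$, then the sequence $\{x_{n}\}_{n=1}^{\infty}$ is convergent and $$\lim_{n\rightarrow\infty}x_{n}=f\Big(\lim_{n\rightarrow\infty}x_{n},\ldots,\lim_{n\rightarrow\infty}x_{n}\Big).$$ If, additionally, $$d(f(u,\ldots,u),f(v,\ldots,v))<d(u,v)$$ holds for all $u,v\in X$ with $u\neq v$, then $x$ is the unique point in $X$ with $f(x,\ldots,x)=x$.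
   Context: For a nonempty set $X$ and a real $b\geq 1$, a map $d:X\times X\to[0,\infty)$ is a $b$-metric on $X$ (and $(X,d)$ is a $b$-metric space with parameter $b$) if for all $x,y,z\in X$: $d(x,y)=0$ if and only if $x=y$; $d(x,y)=d(y,x)$; and $d(x,y)\leq b\,(d(x,z)+d(z,y))$. A sequence $\{x_n\}$ in $X$ is Cauchy if for every $\varepsilon>0$ there is a positive integer $N$ with $d(x_n,x_m)<\varepsilon$ for all $n,m\geq N$; it converges to $x\in X$ (written $\lim_{n\to\infty}x_n=x$) if $\lim_{n\to\infty}d(x_n,x)=0$. $(X,d)$ is complete if every Cauchy sequence in $X$ converges to an element of $X$. *)

theory Defs
  imports Complex_Main "HOL-Library.FuncSet" "HOL-Library.NList"
begin

text \<open>
  Sequences in \<open>X\<close> are functions \<open>nat \<Rightarrow> 'a\<close> of which only the values at positive indices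
  matter; the value at \<open>0\<close> is unconstrained and never used.
  The points of \<open>X^k\<close> are the lists in \<open>nlists k X\<close>.
\<close>

definition b_metric :: "'a set \<Rightarrow> ('a \<Rightarrow> 'a \<Rightarrow> real) \<Rightarrow> real \<Rightarrow> bool" where
  "b_metric X d b \<longleftrightarrow>
     X \<noteq> {} \<and> b \<ge> 1 \<and>
     (\<forall>x\<in>X. \<forall>y\<in>X. 0 \<le> d x y) \<and>
     (\<forall>x\<in>X. \<forall>y\<in>X. d x y = 0 \<longleftrightarrow> x = y) \<and>
     (\<forall>x\<in>X. \<forall>y\<in>X. d x y = d y x) \<and>
     (\<forall>x\<in>X. \<forall>y\<in>X. \<forall>z\<in>X. d x y \<le> b * (d x z + d z y))"

definition b_Cauchy :: "('a \<Rightarrow> 'a \<Rightarrow> real) \<Rightarrow> (nat \<Rightarrow> 'a) \<Rightarrow> bool" where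
  "b_Cauchy d x \<longleftrightarrow> (\<forall>\<epsilon>>0. \<exists>N\<ge>1. \<forall>n\<ge>N. \<forall>m\<ge>N. d (x n) (x m) < \<epsilon>)"

definition b_converges_to :: "'a set \<Rightarrow> ('a \<Rightarrow> 'a \<Rightarrow> real) \<Rightarrow> (nat \<Rightarrow> 'a) \<Rightarrow> 'a \<Rightarrow> bool" where
  "b_converges_to X d x l \<longleftrightarrow> l \<in> X \<and> (\<lambda>n. d (x n) l) \<longlonglongrightarrow> 0"

definition b_convergent :: "'a set \<Rightarrow> ('a \<Rightarrow> 'a \<Rightarrow> real) \<Rightarrow> (nat \<Rightarrow> 'a) \<Rightarrow> bool" where
  "b_convergent X d x \<longleftrightarrow> (\<exists>l. b_converges_to X d x l)"

definition b_lim :: "'a set \<Rightarrow> ('a \<Rightarrow> 'a \<Rightarrow> real) \<Rightarrow> (nat \<Rightarrow> 'a) \<Rightarrow> 'a" where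
  "b_lim X d x = (THE l. b_converges_to X d x l)"

definition b_complete :: "'a set \<Rightarrow> ('a \<Rightarrow> 'a \<Rightarrow> real) \<Rightarrow> bool" where
  "b_complete X d \<longleftrightarrow>
     (\<forall>x. (\<forall>n\<ge>1. x n \<in> X) \<and> b_Cauchy d x \<longrightarrow> b_convergent X d x)"

lemma b_converges_to_unique:
  assumes b: "b_metric X d b" and x: "\<forall>n\<ge>1. x n \<in> X"
    and l: "b_converges_to X d x l" and m: "b_converges_to X d x m"
  shows "l = m"
proof -
  have lm: "l \<in> X" "m \<in> X" and lim: "(\<lambda>n. d (x n) l) \<longlonglongrightarrow> 0" "(\<lambda>n. d (x n) m) \<longlonglongrightarrow> 0"
    using l m by (simp_all add: b_converges_to_def)
  have nonneg: "\<forall>x\<in>X. \<forall>y\<in>X. 0 \<le> d x y" and zero: "\<forall>x\<in>X. \<forall>y\<in>X. d x y = 0 \<longleftrightarrow> x = y"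
    and sym: "\<forall>x\<in>X. \<forall>y\<in>X. d x y = d y x"
    and tri: "\<forall>x\<in>X. \<forall>y\<in>X. \<forall>z\<in>X. d x y \<le> b * (d x z + d z y)"
    using b unfolding b_metric_def by - (elim conjE, assumption)+
  have "(\<lambda>n. b * (d (x n) l + d (x n) m)) \<longlonglongrightarrow> b * (0 + 0)"
    by (intro tendsto_mult tendsto_add tendsto_const lim)
  moreover have "d l m \<le> b * (d (x n) l + d (x n) m)" if "n \<ge> 1" for n
  proof -
    have xn: "x n \<in> X"
      using x that by simp
    show ?thesis
      using bspec[OF bspec[OF bspec[OF tri lm(1)] lm(2)] xn] bspec[OF bspec[OF sym lm(1)] xn]
      by simp
  qed
  ultimately have "d l m \<le> b * (0 + 0)"
    by (intro LIMSEQ_le_const) auto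
  moreover have "0 \<le> d l m"
    using nonneg lm by simp
  ultimately have "d l m = 0"
    by simp
  then show ?thesis
    using zero lm by simp
qed

lemma b_lim_eq:
  assumes "b_metric X d b" and "\<forall>n\<ge>1. x n \<in> X" and "b_converges_to X d x l"
  shows "b_lim X d x = l"
  unfolding b_lim_def
  using assms(3) by (rule the_equality) (rule b_converges_to_unique[OF assms(1,2) _ assms(3)])

end

theory Submission
  imports Defs
begin

text \<open>
  Let \<open>y\<close> satisfy \<open>y (n + k) = f [y n, \<dots>, y (n + k - 1)]\<close>.  By the contraction condition every
  step length \<open>d (y n) (y (n + 1))\<close> is at most \<open>\<eta>\<close> times the maximum of the \<open>k\<close> preceding ones,
  so the step lengths are bounded by \<open>K * \<theta> ^ n\<close> with \<open>\<theta> = root k \<eta> < 1\<close>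
  (\<open>presic_geometric_bound\<close>).

  In a \<open>b\<close>-metric space iterating the triangle inequality over \<open>j\<close> steps costs a factor \<open>b ^ j\<close>,
  and \<open>b * \<theta> < 1\<close> may fail, so the geometric series cannot be summed directly.  Instead one fixes
  a block length \<open>p\<close> with \<open>b * \<theta> ^ p \<le> 1 / 2\<close>.  Within a block the cost is a constant, and each
  passage from one block to the next loses a factor \<open>b\<close> but gains \<open>\<theta> ^ p\<close>; hence the sequence is
  Cauchy (\<open>geometric_steps_dist_bound\<close>) and has a limit \<open>l\<close>.

  A \<open>b\<close>-metric need not be continuous and \<open>f\<close> is only controlled on overlapping tuples, so to
  compare \<open>y (n + k)\<close> with \<open>f [l, \<dots>, l]\<close> one slides the window of length \<open>k\<close> along the sequence
  \<open>y n, \<dots>, y (n + k - 1), l, l, \<dots>\<close>: after \<open>k\<close> shifts the window contains only \<open>l\<close>, each shift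
  moves the value of \<open>f\<close> by little, and the number of shifts does not depend on \<open>n\<close>.
  Therefore \<open>l\<close> is a diagonal fixed point (\<open>orbit_limit_fixed\<close>).
  Existence follows by running the recursion from a constant start, and uniqueness is immediate
  from the strict contraction on the diagonal.
\<close>

section \<open>Chains of points in \<open>b\<close>-metric spaces\<close>

text \<open>
  Gives the fields of \<open>b_metric\<close> as separate rules; \<open>X\<close> is a carrier set, so all of them are
  relativised to it.
\<close>

locale b_metric_space =
  fixes X :: "'a set" and d :: "'a \<Rightarrow> 'a \<Rightarrow> real" and b :: real
  assumes b_metric: "b_metric X d b"
begin

lemma b_ge_1: "1 \<le> b"
  using b_metric unfolding b_metric_def by (elim conjE)

lemma dist_nonneg: "x \<in> X \<Longrightarrow> y \<in> X \<Longrightarrow> 0 \<le> d x y"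
  using b_metric unfolding b_metric_def by blast

lemma dist_eq_0_iff: "x \<in> X \<Longrightarrow> y \<in> X \<Longrightarrow> d x y = 0 \<longleftrightarrow> x = y"
  using b_metric unfolding b_metric_def by blast

lemma dist_self: "x \<in> X \<Longrightarrow> d x x = 0"
  by (simp add: dist_eq_0_iff)

lemma dist_sym: "x \<in> X \<Longrightarrow> y \<in> X \<Longrightarrow> d x y = d y x"
  using b_metric unfolding b_metric_def by blast

lemma dist_triangle:
  "x \<in> X \<Longrightarrow> y \<in> X \<Longrightarrow> z \<in> X \<Longrightarrow> d x y \<le> b * (d x z + d z y)"
  using b_metric unfolding b_metric_def by blast

lemma chain_dist_bound:
  assumes "\<And>i. i \<le> j \<Longrightarrow> y i \<in> X"
    and "\<And>i. i < j \<Longrightarrow> d (y i) (y (Suc i)) \<le> e"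
    and "0 \<le> e"
  shows "d (y 0) (y j) \<le> real j * b ^ j * e"
  using assms
proof (induction j)
  case 0
  then show ?case by (simp add: dist_self)
next
  case (Suc j)
  have IH: "d (y 0) (y j) \<le> real j * b ^ j * e"
    using Suc by simp
  have "d (y 0) (y (Suc j)) \<le> b * (d (y 0) (y j) + d (y j) (y (Suc j)))"
    by (intro dist_triangle Suc.prems) auto
  also have "\<dots> \<le> b * (real j * b ^ j * e + b ^ j * e)"
  proof (intro mult_left_mono add_mono IH)
    have "d (y j) (y (Suc j)) \<le> 1 * e"
      using Suc.prems by simp
    also have "\<dots> \<le> b ^ j * e"
      using b_ge_1 \<open>0 \<le> e\<close> by (intro mult_right_mono one_le_power)
    finally show "d (y j) (y (Suc j)) \<le> b ^ j * e" .
  qed (use b_ge_1 in simp)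
  also have "\<dots> = real (Suc j) * b ^ Suc j * e"
    by (simp add: algebra_simps)
  finally show ?case .
qed

text \<open>
  Geometric decay of the step lengths with an arbitrary ratio below \<open>1\<close> bounds all distances;
  no relation between \<open>\<theta>\<close> and \<open>b\<close> is needed.
\<close>

lemma geometric_steps_dist_bound:
  assumes y: "\<And>n. y n \<in> X"
    and step: "\<And>n. d (y n) (y (Suc n)) \<le> K * \<theta> ^ n"
    and \<theta>: "0 < \<theta>" "\<theta> < 1"
  shows "\<exists>C\<ge>0. \<forall>n j. d (y n) (y (n + j)) \<le> C * \<theta> ^ n"
proof -
  have b: "1 \<le> b" by (rule b_ge_1)
  have K: "0 \<le> K"
    using step[of 0] dist_nonneg[OF y y, of 0 1] by simp
  obtain p0 where "\<theta> ^ p0 < 1 / (2 * b)"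
    using real_arch_pow_inv[of "1 / (2 * b)" \<theta>] \<theta> b by auto
  moreover define p where "p = Suc p0"
  moreover have "\<theta> * \<theta> ^ p0 \<le> \<theta> ^ p0"
    using \<theta> by (intro mult_left_le_one_le) auto
  ultimately have "\<theta> ^ p \<le> 1 / (2 * b)" and p: "0 < p"
    by simp_all
  then have bp: "b * \<theta> ^ p \<le> 1 / 2"
    using b by (simp add: field_simps)
  \<comment> \<open>\<open>A\<close> is the cost of at most \<open>p\<close> consecutive steps, relative to \<open>\<theta> ^ n\<close>.\<close>
  define A where "A = real p * b ^ p * K"
  have A: "0 \<le> A"
    using K b by (simp add: A_def)
  have block: "d (y n) (y (n + j)) \<le> A * \<theta> ^ n" if "j \<le> p" for n j
  proof -
    have "d (y (n + 0)) (y (n + j)) \<le> real j * b ^ j * (K * \<theta> ^ n)"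
    proof (rule chain_dist_bound[where y = "\<lambda>i. y (n + i)"])
      fix i
      have "d (y (n + i)) (y (n + Suc i)) \<le> K * \<theta> ^ (n + i)"
        using step[of "n + i"] by simp
      also have "\<dots> \<le> K * \<theta> ^ n"
        using K \<theta> by (intro mult_left_mono power_decreasing) auto
      finally show "d (y (n + i)) (y (n + Suc i)) \<le> K * \<theta> ^ n" .
    qed (use y K \<theta> in auto)
    also have "\<dots> \<le> real p * b ^ p * (K * \<theta> ^ n)"
      using that b K \<theta> by (intro mult_right_mono mult_mono power_increasing) auto
    finally show ?thesis by (simp add: A_def mult.assoc)
  qed
  have "d (y n) (y (n + j)) \<le> 2 * b * A * \<theta> ^ n" for n j
  proof (induction j arbitrary: n rule: less_induct)
    case (less j)
    show ?case
    proof (cases "j \<le> p")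
      case True
      have "A * \<theta> ^ n \<le> 2 * b * A * \<theta> ^ n"
        using b A \<theta> mult_right_mono[of 1 "2 * b" "A * \<theta> ^ n"] by (simp add: mult.assoc)
      then show ?thesis
        using block[OF True, of n] by linarith
    next
      case False
      have rest: "d (y (n + p)) (y (n + j)) \<le> 2 * b * A * \<theta> ^ (n + p)"
        using less.IH[of "j - p" "n + p"] False p by simp
      have "d (y n) (y (n + j)) \<le> b * (d (y n) (y (n + p)) + d (y (n + p)) (y (n + j)))"
        by (intro dist_triangle y)
      also have "\<dots> \<le> b * (A * \<theta> ^ n + 2 * b * A * \<theta> ^ (n + p))"
        using b by (intro mult_left_mono add_mono block rest) auto
      also have "\<dots> = b * A * \<theta> ^ n + 2 * (b * A * \<theta> ^ n) * (b * \<theta> ^ p)"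
        by (simp add: power_add algebra_simps)
      also have "\<dots> \<le> b * A * \<theta> ^ n + 2 * (b * A * \<theta> ^ n) * (1 / 2)"
        using b A \<theta> by (intro add_left_mono mult_left_mono bp) auto
      finally show ?thesis by (simp add: algebra_simps)
    qed
  qed
  moreover have "0 \<le> 2 * b * A"
    using b A by simp
  ultimately show ?thesis by blast
qed

lemma geometric_steps_Cauchy:
  assumes y: "\<And>n. y n \<in> X"
    and step: "\<And>n. d (y n) (y (Suc n)) \<le> K * \<theta> ^ n"
    and \<theta>: "0 < \<theta>" "\<theta> < 1"
  shows "b_Cauchy d y"
  unfolding b_Cauchy_def
proof (intro allI impI)
  fix e :: real
  assume e: "0 < e"
  obtain C where C: "0 \<le> C" and bound: "\<And>n j. d (y n) (y (n + j)) \<le> C * \<theta> ^ n"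
    using geometric_steps_dist_bound[OF assms] by blast
  have "(\<lambda>n. C * \<theta> ^ n) \<longlonglongrightarrow> C * 0"
    using \<theta> by (intro tendsto_intros LIMSEQ_power_zero) auto
  then have "\<forall>\<^sub>F n in sequentially. C * \<theta> ^ n < e"
    using e order_tendstoD(2) by fastforce
  then obtain N where N: "\<And>n. N \<le> n \<Longrightarrow> C * \<theta> ^ n < e"
    by (auto simp: eventually_sequentially)
  have *: "d (y n) (y m) < e" if "N \<le> n" "n \<le> m" for n m
    using bound[of n "m - n"] N[of n] that by simp
  have "d (y n) (y m) < e" if "N \<le> n" "N \<le> m" for n m
    using *[of n m] *[of m n] dist_sym[OF y y, of n m] that by (cases "n \<le> m") auto
  then show "\<exists>N\<ge>1. \<forall>n\<ge>N. \<forall>m\<ge>N. d (y n) (y m) < e"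
    by (intro exI[of _ "Suc N"]) auto
qed

end

section \<open>Contractions in several variables\<close>

text \<open>
  A sequence in which every term is at most \<open>\<eta>\<close> times a bound for the preceding \<open>k\<close> terms
  decays geometrically, with ratio \<open>root k \<eta>\<close>.
\<close>

lemma presic_geometric_bound:
  fixes D :: "nat \<Rightarrow> real"
  assumes k: "0 < k" and \<eta>: "0 < \<eta>" "\<eta> < 1"
    and rec: "\<And>n e. (\<And>i. n \<le> i \<Longrightarrow> i < n + k \<Longrightarrow> D i \<le> e) \<Longrightarrow> D (n + k) \<le> \<eta> * e"
  shows "\<exists>K \<theta>. 0 < \<theta> \<and> \<theta> < 1 \<and> (\<forall>n. D n \<le> K * \<theta> ^ n)"
proof -
  define \<theta> where "\<theta> = root k \<eta>"
  have \<theta>: "0 < \<theta>" "\<theta> < 1" "\<theta> ^ k = \<eta>"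
    using k \<eta> by (auto simp: \<theta>_def)
  define K where "K = (\<Sum>i<k. \<bar>D i\<bar> / \<theta> ^ i)"
  have K: "0 \<le> K"
    using \<theta> by (auto simp: K_def intro!: sum_nonneg)
  have "D n \<le> K * \<theta> ^ n" for n
  proof (induction n rule: less_induct)
    case (less n)
    show ?case
    proof (cases "n < k")
      case True
      have "\<bar>D n\<bar> / \<theta> ^ n \<le> K"
        unfolding K_def using True \<theta> by (intro member_le_sum) auto
      then have "\<bar>D n\<bar> \<le> K * \<theta> ^ n"
        using \<theta> by (simp add: pos_divide_le_eq)
      then show ?thesis by linarith
    next
      case False
      define m where "m = n - k"
      have n: "n = m + k"
        using False by (simp add: m_def)
      have "D i \<le> K * \<theta> ^ m" if "m \<le> i" "i < m + k" for i
      proof -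
        have "D i \<le> K * \<theta> ^ i"
          using that n by (intro less.IH) auto
        also have "\<dots> \<le> K * \<theta> ^ m"
          using that K \<theta> by (intro mult_left_mono power_decreasing) auto
        finally show ?thesis .
      qed
      then have "D (m + k) \<le> \<eta> * (K * \<theta> ^ m)"
        by (rule rec)
      also have "\<dots> = K * \<theta> ^ n"
        by (simp add: n power_add \<theta>(3))
      finally show ?thesis by (simp add: n)
    qed
  qed
  with \<theta> show ?thesis by blast
qed

text \<open>
  A self-map \<open>f\<close> of \<open>k\<close> variables that contracts neighbouring windows of any sequence.
  The maximum over a window is replaced by an arbitrary bound \<open>e\<close> for its step lengths.
\<close>

locale presic_contraction = b_metric_space X d b
  for X :: "'a set" and d b +
  fixes k :: nat and f :: "'a list \<Rightarrow> 'a" and \<eta> :: real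
  assumes complete: "b_complete X d"
    and k_pos: "0 < k"
    and f_closed: "f \<in> nlists k X \<rightarrow> X"
    and \<eta>: "0 < \<eta>" "\<eta> < 1"
    and window_contraction:
      "\<And>z n e. (\<And>i. z i \<in> X) \<Longrightarrow>
        (\<And>i. n \<le> i \<Longrightarrow> i < n + k \<Longrightarrow> d (z i) (z (Suc i)) \<le> e) \<Longrightarrow>
        d (f (map z [n..<n + k])) (f (map z [Suc n..<Suc n + k])) \<le> \<eta> * e"
begin

lemma f_window_in: "(\<And>i. z i \<in> X) \<Longrightarrow> f (map z [n..<n + k]) \<in> X"
  by (intro funcset_mem[OF f_closed] nlistsI) auto

lemma orbit_convergent:
  assumes y: "\<And>n. y n \<in> X"
    and rec: "\<And>n. y (n + k) = f (map y [n..<n + k])"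
  shows "\<exists>l. b_converges_to X d y l"
proof -
  have "d (y (n + k)) (y (Suc (n + k))) \<le> \<eta> * e"
    if "\<And>i. n \<le> i \<Longrightarrow> i < n + k \<Longrightarrow> d (y i) (y (Suc i)) \<le> e" for n e
  proof -
    have "d (f (map y [n..<n + k])) (f (map y [Suc n..<Suc n + k])) \<le> \<eta> * e"
      by (rule window_contraction) (fact y, fact that)
    then show ?thesis
      unfolding rec[symmetric] by simp
  qed
  then have "\<exists>K \<theta>. 0 < \<theta> \<and> \<theta> < 1 \<and> (\<forall>n. d (y n) (y (Suc n)) \<le> K * \<theta> ^ n)"
    by (rule presic_geometric_bound[OF k_pos \<eta>])
  then obtain K \<theta> where \<theta>: "0 < \<theta>" "\<theta> < 1"
    and step: "\<And>n. d (y n) (y (Suc n)) \<le> K * \<theta> ^ n"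
    by blast
  have "b_Cauchy d y"
    by (rule geometric_steps_Cauchy[OF y step \<theta>])
  then have "b_convergent X d y"
    using complete y unfolding b_complete_def by blast
  then show ?thesis
    unfolding b_convergent_def .
qed

lemma orbit_limit_fixed:
  assumes y: "\<And>n. y n \<in> X"
    and rec: "\<And>n. y (n + k) = f (map y [n..<n + k])"
    and lim: "b_converges_to X d y l"
  shows "f (replicate k l) = l"
proof -
  have b: "1 \<le> b" by (rule b_ge_1)
  have l: "l \<in> X" and to_l: "(\<lambda>n. d (y n) l) \<longlonglongrightarrow> 0"
    using lim by (auto simp: b_converges_to_def)
  have fl: "f (replicate k l) \<in> X"
    using f_window_in[of "\<lambda>_. l" 0] l by (simp add: map_replicate_const)
  \<comment> \<open>Steps of length at most \<open>2 * b * e\<close>, chained \<open>k\<close> times, and one more triangle inequality.\<close>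
  define C where "C = b * (1 + real k * b ^ k * (2 * b))"
  have C: "0 < C"
    using b by (auto simp: C_def intro!: mult_pos_pos add_pos_nonneg)
  have "d l (f (replicate k l)) \<le> C * e" if e: "0 < e" for e
  proof -
    obtain n where near: "\<And>m. n \<le> m \<Longrightarrow> d (y m) l < e"
      using order_tendstoD(2)[OF to_l e] by (auto simp: eventually_sequentially)
    \<comment> \<open>\<open>F j\<close> is the value of \<open>f\<close> after \<open>j\<close> shifts of the window along \<open>z\<close>.\<close>
    define z where "z i = (if i < k then y (n + i) else l)" for i
    define F where "F j = f (map z [j..<j + k])" for j
    have z: "z i \<in> X" for i
      using y l by (simp add: z_def)
    have z_near: "d (z i) l \<le> e" for i
      using near[of "n + i"] e l by (simp add: z_def dist_self)
    have z_step: "d (z i) (z (Suc i)) \<le> 2 * b * e" for i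
    proof -
      have "d (z i) (z (Suc i)) \<le> b * (d (z i) l + d l (z (Suc i)))"
        by (intro dist_triangle z l)
      also have "\<dots> \<le> b * (e + e)"
        using b z_near[of i] z_near[of "Suc i"] dist_sym[OF l z]
        by (intro mult_left_mono add_mono) auto
      finally show ?thesis by simp
    qed
    have F_in: "F j \<in> X" for j
      unfolding F_def by (rule f_window_in) (rule z)
    have F_step: "d (F j) (F (Suc j)) \<le> 2 * b * e" for j
    proof -
      have "d (F j) (F (Suc j)) \<le> \<eta> * (2 * b * e)"
        unfolding F_def by (intro window_contraction z z_step)
      also have "\<dots> \<le> 1 * (2 * b * e)"
        using \<eta> b e by (intro mult_right_mono) auto
      finally show ?thesis by simp
    qed
    have F_dist: "d (F 0) (F k) \<le> real k * b ^ k * (2 * b * e)"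
      by (rule chain_dist_bound) (use F_in F_step b e in auto)
    have "map z [0..<k] = map y [n..<n + k]"
      by (rule nth_equalityI) (auto simp: z_def)
    then have F0: "F 0 = y (n + k)"
      unfolding F_def rec[of n] by simp
    have "map z [k..<k + k] = replicate k l"
      by (rule nth_equalityI) (auto simp: z_def)
    then have Fk: "F k = f (replicate k l)"
      by (simp add: F_def)
    have "d l (F k) \<le> b * (d l (F 0) + d (F 0) (F k))"
      by (intro dist_triangle l F_in)
    also have "\<dots> \<le> b * (e + real k * b ^ k * (2 * b * e))"
    proof (intro mult_left_mono add_mono F_dist)
      show "d l (F 0) \<le> e"
        using near[of "n + k"] dist_sym[OF l F_in, of 0] by (simp add: F0)
    qed (use b in simp)
    also have "\<dots> = C * e"
      by (simp add: C_def algebra_simps)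
    finally show ?thesis by (simp add: Fk)
  qed
  from this[of "e / C" for e] have small: "d l (f (replicate k l)) \<le> e" if "0 < e" for e
    using that C by simp
  have "d l (f (replicate k l)) \<le> 0"
    by (rule field_le_epsilon) (simp add: small)
  then have "d l (f (replicate k l)) = 0"
    using dist_nonneg[OF l fl] by simp
  then show ?thesis
    using dist_eq_0_iff[OF l fl] by simp
qed

end

text \<open>
  The sequence with recursion map \<open>f\<close> of \<open>k\<close> variables whose first \<open>k\<close> terms, those with
  indices below \<open>k\<close>, equal \<open>a\<close>.
\<close>

fun constant_start_orbit :: "('a list \<Rightarrow> 'a) \<Rightarrow> nat \<Rightarrow> 'a \<Rightarrow> nat \<Rightarrow> 'a" where
  "constant_start_orbit f k a n =
     (if n < k then a else f (map (constant_start_orbit f k a) [n - k..<n]))"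

declare constant_start_orbit.simps [simp del]

lemma constant_start_orbit_rec:
  "constant_start_orbit f k a (n + k) = f (map (constant_start_orbit f k a) [n..<n + k])"
  by (subst constant_start_orbit.simps) simp

lemma constant_start_orbit_init: "n < k \<Longrightarrow> constant_start_orbit f k a n = a"
  by (subst constant_start_orbit.simps) simp

lemma recursive_sequence_in:
  assumes f: "f \<in> nlists k X \<rightarrow> X"
    and init: "\<And>n. n < k \<Longrightarrow> y n \<in> X"
    and rec: "\<And>n. y (n + k) = f (map y [n..<n + k])"
  shows "y n \<in> X"
proof (induction n rule: less_induct)
  case (less n)
  show ?case
  proof (cases "n < k")
    case False
    have "map y [n - k..<n] \<in> nlists k X"
      using less False by (intro nlistsI) auto
    then have "f (map y [n - k..<n]) \<in> X"
      by (rule funcset_mem[OF f])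
    then show ?thesis
      using rec[of "n - k"] False by simp
  qed (rule init)
qed

section \<open>Fixed points on the diagonal\<close>

theorem theorem7:
  fixes X :: "'a set" and d :: "'a \<Rightarrow> 'a \<Rightarrow> real" and b \<eta> :: real
    and k :: nat and f :: "'a list \<Rightarrow> 'a"
  assumes "b_metric X d b"
    and "b_complete X d"
    and "k \<ge> 1"
    and "f \<in> nlists k X \<rightarrow> X"
    and "0 < \<eta>" and "\<eta> < 1"
    and "\<And>x :: nat \<Rightarrow> 'a. (\<forall>i\<in>{1..k+1}. x i \<in> X) \<Longrightarrow>
           d (f (map x [1..<k+1])) (f (map x [2..<k+2]))
             \<le> \<eta> * (MAX i\<in>{1..k}. d (x i) (x (i+1)))"
  shows "(\<exists>x\<in>X. f (replicate k x) = x) \<and>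
         (\<forall>x :: nat \<Rightarrow> 'a.
            (\<forall>i\<in>{1..k}. x i \<in> X) \<and> (\<forall>n\<ge>1. x (n+k) = f (map x [n..<n+k])) \<longrightarrow>
            b_convergent X d x \<and> b_lim X d x = f (replicate k (b_lim X d x))) \<and>
         ((\<forall>u\<in>X. \<forall>v\<in>X. u \<noteq> v \<longrightarrow> d (f (replicate k u)) (f (replicate k v)) < d u v) \<longrightarrow>
            (\<exists>!x. x \<in> X \<and> f (replicate k x) = x))"
proof -
  interpret b_metric_space X d b
    by unfold_locales fact
  interpret presic_contraction X d b k f \<eta>
  proof unfold_locales
    fix z :: "nat \<Rightarrow> 'a" and n e
    assume z: "\<And>i. z i \<in> X"
      and e: "\<And>i. n \<le> i \<Longrightarrow> i < n + k \<Longrightarrow> d (z i) (z (Suc i)) \<le> e"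
    \<comment> \<open>The hypothesis on \<open>f\<close> concerns windows starting at index 1, so \<open>z\<close> is shifted.\<close>
    define x where "x i = z (n + i - 1)" for i
    have eqs: "map x [1..<k + 1] = map z [n..<n + k]"
      "map x [2..<k + 2] = map z [Suc n..<Suc n + k]"
      by (auto simp: x_def simp del: upt_Suc intro!: nth_equalityI)
    have "d (f (map x [1..<k + 1])) (f (map x [2..<k + 2]))
        \<le> \<eta> * (MAX i\<in>{1..k}. d (x i) (x (i + 1)))"
      by (rule assms(7)) (simp add: x_def z)
    also have "\<dots> \<le> \<eta> * e"
    proof (rule mult_left_mono)
      show "(MAX i\<in>{1..k}. d (x i) (x (i + 1))) \<le> e"
      proof (rule Max.boundedI)
        fix a
        assume "a \<in> (\<lambda>i. d (x i) (x (i + 1))) ` {1..k}"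
        then obtain i where i: "1 \<le> i" "i \<le> k" and a: "a = d (x i) (x (i + 1))"
          by auto
        then have "Suc (n + i - 1) = n + i"
          by simp
        then show "a \<le> e"
          using e[of "n + i - 1"] i by (simp add: a x_def)
      qed (use \<open>k \<ge> 1\<close> in auto)
    qed (use \<open>0 < \<eta>\<close> in simp)
    finally show "d (f (map z [n..<n + k])) (f (map z [Suc n..<Suc n + k])) \<le> \<eta> * e"
      unfolding eqs .
  qed (use assms in auto)

  have existence: "\<exists>x\<in>X. f (replicate k x) = x"
  proof -
    obtain a where a: "a \<in> X"
      using assms(1) unfolding b_metric_def by blast
    define y where "y = constant_start_orbit f k a"
    have rec: "y (n + k) = f (map y [n..<n + k])" for n
      unfolding y_def by (rule constant_start_orbit_rec)
    have "y n \<in> X" if "n < k" for n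
      using that a by (simp add: y_def constant_start_orbit_init)
    then have y: "y n \<in> X" for n
      using recursive_sequence_in[OF f_closed _ rec] by blast
    obtain l where "b_converges_to X d y l"
      using orbit_convergent[OF y rec] by blast
    then show ?thesis
      using orbit_limit_fixed[OF y rec] by (auto simp: b_converges_to_def)
  qed

  have convergence: "b_convergent X d x \<and> b_lim X d x = f (replicate k (b_lim X d x))"
    if init: "\<forall>i\<in>{1..k}. x i \<in> X" and x_rec: "\<forall>n\<ge>1. x (n + k) = f (map x [n..<n + k])"
    for x :: "nat \<Rightarrow> 'a"
  proof -
    \<comment> \<open>Dropping the unconstrained term \<open>x 0\<close> gives an orbit indexed from 0.\<close>
    define y where "y n = x (Suc n)" for n
    have rec: "y (n + k) = f (map y [n..<n + k])" for n
    proof -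
      have window: "map x [Suc n..<Suc n + k] = map y [n..<n + k]"
        by (auto simp: y_def simp del: upt_Suc intro!: nth_equalityI)
      have "y (n + k) = x (Suc n + k)"
        by (simp add: y_def)
      also have "\<dots> = f (map x [Suc n..<Suc n + k])"
        using x_rec[rule_format, of "Suc n"] by (simp del: upt_Suc)
      finally show ?thesis
        unfolding window .
    qed
    have "y n \<in> X" if "n < k" for n
      using that init by (simp add: y_def)
    then have y: "y n \<in> X" for n
      using recursive_sequence_in[OF f_closed _ rec] by blast
    obtain l where l: "b_converges_to X d y l"
      using orbit_convergent[OF y rec] by blast
    then have x_lim: "b_converges_to X d x l"
      using filterlim_sequentially_Suc[of "\<lambda>n. d (x n) l"]
      by (simp add: b_converges_to_def y_def)
    have "x n \<in> X" if "n \<ge> 1" for n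
      using y[of "n - 1"] that by (simp add: y_def)
    then have "b_lim X d x = l"
      using b_lim_eq[OF assms(1) _ x_lim] by blast
    then show ?thesis
      using x_lim orbit_limit_fixed[OF y rec l] by (auto simp: b_convergent_def)
  qed

  have "\<exists>!x. x \<in> X \<and> f (replicate k x) = x"
    if "\<forall>u\<in>X. \<forall>v\<in>X. u \<noteq> v \<longrightarrow> d (f (replicate k u)) (f (replicate k v)) < d u v"
    using existence that by (metis less_irrefl)
  then show ?thesis
    using existence convergence by blast
qed

end
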